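(* Let $M\in\Lambda^{001}$ be unsolvable and let $C$ be a 001-infinitary context. If $C[M]$ has a β-normal form $C^*$, i.e. $C^*\in\Lambda^{001}$ contains no β-redex and $C[M]\longrightarrow_\beta^\infty C^*$, then for every $N\in\Lambda^{001}$, $C[N]\longrightarrow_\beta^\infty C^*$.
   Context: $\Lambda^{001}=\nu Y.\mu X.(\mathcal V+\lambda\mathcal V.X+(X)Y)$: possibly infinite λ-terms (trees of variables, abstractions and applications $(M)N$) whose infinite branches all enter infinitely often the argument position $N$ of an application, up to α-equivalence. $\longrightarrow_\beta^*$ is the reflexive-transitive closure of one-step β-reduction (contextual closure of $(\lambda x.M)N\to M[N/x]$); $\longrightarrow_\beta^\infty$ is defined by the rules (var) $M\longrightarrow_\beta^* x\Rightarrow M\longrightarrow_\beta^\infty x$, (λ) $M\longrightarrow_\beta^*\lambda x.P$, $P\longrightarrow_\beta^\infty P'\Rightarrow M\longrightarrow_\beta^\infty\lambda x.P'$, (@) $M\longrightarrow_\beta^*(P)Q$, $P\longrightarrow_\beta^\infty P'$, $Q\longrightarrow_\beta^\infty Q'\Rightarrow M\longrightarrow_\beta^\infty(P')Q'$, with possibly infinite derivations in which every infinite branch crosses infinitely often the third premise of (@). $M$ is solvable if there are variables $x_1,\dots,x_m$ and terms $N_1,\dots,N_n\in\Lambda^{001}$ with $(\dots((\lambda x_1\dots\lambda x_m.M)N_1)\dots)N_n\longrightarrow_\beta^\infty\lambda x.x$, and unsolvable otherwise. A 001-infinitary context is an element of $\nu Y.\mu X.(\mathcal V+\lambda\mathcal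 V.X+(X)Y+* )$, i.e. a term of the same shape possibly containing occurrences of a constant hole $*$; $C[M]$ is the term obtained by replacing every occurrence of $*$ in $C$ by $M$ (without capture avoidance). *)

theory Defs
  imports Main
begin

text \<open>Free variables are named by natural numbers: at depth d (under d binders) the free
variable x is represented by index d + x.\<close>

codatatype trm = Var nat | Lam trm | App trm trm

primcorec ren :: "(nat \<Rightarrow> nat) \<Rightarrow> nat \<Rightarrow> trm \<Rightarrow> trm" where
  "ren f c M = (case M of
      Var n \<Rightarrow> Var (if n < c then n else f (n - c) + c)
    | Lam P \<Rightarrow> Lam (ren f (Suc c) P)
    | App P Q \<Rightarrow> App (ren f c P) (ren f c Q))"

text \<open>Named abstraction lambda x. M: binds the free variable x, other free variables keep their names.\<close>
definition abstr :: "nat \<Rightarrow> trm \<Rightarrow> trm" where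
  "abstr x M = Lam (ren (\<lambda>j. if j = x then 0 else Suc j) 0 M)"

text \<open>Substitution for the outermost bound variable (used for beta).  State Inl (M,k,N):
substitute N (already lifted to the current depth) for index k in M, decrementing free
indices above k; state Inr P: copy P.\<close>
primcorec bsub :: "(trm \<times> nat \<times> trm) + trm \<Rightarrow> trm" where
  "bsub s = (case s of
      Inr P \<Rightarrow> (case P of
          Var n \<Rightarrow> Var n
        | Lam A \<Rightarrow> Lam (bsub (Inr A))
        | App A B \<Rightarrow> App (bsub (Inr A)) (bsub (Inr B)))
    | Inl (M, k, N) \<Rightarrow> (case M of
          Var n \<Rightarrow> (if n = k then (case N of
                          Var m \<Rightarrow> Var m
                        | Lam A \<Rightarrow> Lam (bsub (Inr A))
                        | App A B \<Rightarrow> App (bsub (Inr A)) (bsub (Inr B)))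
                     else if n < k then Var n else Var (n - 1))
        | Lam A \<Rightarrow> Lam (bsub (Inl (A, Suc k, ren Suc 0 N)))
        | App A B \<Rightarrow> App (bsub (Inl (A, k, N))) (bsub (Inl (B, k, N)))))"

definition subst :: "trm \<Rightarrow> trm \<Rightarrow> trm" where
  "subst M N = bsub (Inl (M, 0, N))"

section \<open>The 001 condition: nu Y. mu X. (V + lambda V. X + (X) Y)\<close>

inductive t001_step :: "(trm \<Rightarrow> bool) \<Rightarrow> trm \<Rightarrow> bool" for Y where
  "t001_step Y (Var x)"
| "t001_step Y M \<Longrightarrow> t001_step Y (Lam M)"
| "t001_step Y M \<Longrightarrow> Y N \<Longrightarrow> t001_step Y (App M N)"

lemma t001_step_mono[mono]:
  "(\<And>x. Y x \<longrightarrow> Y' x) \<Longrightarrow> t001_step Y M \<longrightarrow> t001_step Y' M"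
proof
  assume h: "\<And>x. Y x \<longrightarrow> Y' x" and "t001_step Y M"
  from \<open>t001_step Y M\<close> show "t001_step Y' M"
    by (induction rule: t001_step.induct) (use h in \<open>auto intro: t001_step.intros\<close>)
qed

coinductive t001 :: "trm \<Rightarrow> bool" where
  "t001_step t001 M \<Longrightarrow> t001 M"

inductive beta :: "trm \<Rightarrow> trm \<Rightarrow> bool" where
  "beta (App (Lam M) N) (subst M N)"
| "beta M M' \<Longrightarrow> beta (Lam M) (Lam M')"
| "beta M M' \<Longrightarrow> beta (App M N) (App M' N)"
| "beta N N' \<Longrightarrow> beta (App M N) (App M N')"

abbreviation beta_star :: "trm \<Rightarrow> trm \<Rightarrow> bool" where
  "beta_star \<equiv> beta\<^sup>*\<^sup>*"

text \<open>Infinitary reduction: nu Y. mu X. with the argument premise of (@) coinductive.\<close>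
inductive binf_step :: "(trm \<Rightarrow> trm \<Rightarrow> bool) \<Rightarrow> trm \<Rightarrow> trm \<Rightarrow> bool" for Y where
  bvar: "beta_star M (Var x) \<Longrightarrow> binf_step Y M (Var x)"
| blam: "beta_star M (Lam P) \<Longrightarrow> binf_step Y P P' \<Longrightarrow> binf_step Y M (Lam P')"
| bapp: "beta_star M (App P Q) \<Longrightarrow> binf_step Y P P' \<Longrightarrow> Y Q Q' \<Longrightarrow> binf_step Y M (App P' Q')"

lemma binf_step_mono[mono]:
  "(\<And>x y. Y x y \<longrightarrow> Y' x y) \<Longrightarrow> binf_step Y M N \<longrightarrow> binf_step Y' M N"
proof
  assume h: "\<And>x y. Y x y \<longrightarrow> Y' x y" and "binf_step Y M N"
  from \<open>binf_step Y M N\<close> show "binf_step Y' M N"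
    by (induction rule: binf_step.induct) (use h in \<open>auto intro: binf_step.intros\<close>)
qed

coinductive binf :: "trm \<Rightarrow> trm \<Rightarrow> bool" where
  "binf_step binf M N \<Longrightarrow> binf M N"

definition solvable :: "trm \<Rightarrow> bool" where
  "solvable M \<longleftrightarrow> (\<exists>xs Ns. (\<forall>N\<in>set Ns. t001 N) \<and>
      binf (foldl App (foldr abstr xs M) Ns) (Lam (Var 0)))"

inductive has_redex :: "trm \<Rightarrow> bool" where
  "has_redex (App (Lam M) N)"
| "has_redex M \<Longrightarrow> has_redex (Lam M)"
| "has_redex M \<Longrightarrow> has_redex (App M N)"
| "has_redex N \<Longrightarrow> has_redex (App M N)"

section \<open>001-infinitary contexts (named binders, since plugging is capture-permitting)\<close>

codatatype ctx = CVar nat | CLam nat ctx | CApp ctx ctx | Hole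

inductive c001_step :: "(ctx \<Rightarrow> bool) \<Rightarrow> ctx \<Rightarrow> bool" for Y where
  "c001_step Y (CVar x)"
| "c001_step Y Hole"
| "c001_step Y C \<Longrightarrow> c001_step Y (CLam x C)"
| "c001_step Y C \<Longrightarrow> Y D \<Longrightarrow> c001_step Y (CApp C D)"

lemma c001_step_mono[mono]:
  "(\<And>x. Y x \<longrightarrow> Y' x) \<Longrightarrow> c001_step Y C \<longrightarrow> c001_step Y' C"
proof
  assume h: "\<And>x. Y x \<longrightarrow> Y' x" and "c001_step Y C"
  from \<open>c001_step Y C\<close> show "c001_step Y' C"
    by (induction rule: c001_step.induct) (use h in \<open>auto intro: c001_step.intros\<close>)
qed

coinductive c001 :: "ctx \<Rightarrow> bool" where
  "c001_step c001 C \<Longrightarrow> c001 C"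

text \<open>Resolution of a named variable x under the binders env (innermost first):
de Bruijn index of the nearest binder named x, or the free-variable index.\<close>
definition resolve :: "nat list \<Rightarrow> nat \<Rightarrow> nat" where
  "resolve env x = (if x \<in> set env then (LEAST i. i < length env \<and> env ! i = x)
                    else length env + x)"

text \<open>Plugging, without capture avoidance: the free variable x of M placed at the hole
is bound by the nearest enclosing binder lambda x of C, if any.  State Inl (env, C);
state Inr P: copy P.\<close>
primcorec plug_aux :: "(nat list \<times> ctx \<times> trm) + trm \<Rightarrow> trm" where
  "plug_aux s = (case s of
      Inr P \<Rightarrow> (case P of
          Var n \<Rightarrow> Var n
        | Lam A \<Rightarrow> Lam (plug_aux (Inr A))
        | App A B \<Rightarrow> App (plug_aux (Inr A)) (plug_aux (Inr B)))
    | Inl (env, C, M) \<Rightarrow> (case C of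
          CVar x \<Rightarrow> Var (resolve env x)
        | CLam x D \<Rightarrow> Lam (plug_aux (Inl (x # env, D, M)))
        | CApp D E \<Rightarrow> App (plug_aux (Inl (env, D, M))) (plug_aux (Inl (env, E, M)))
        | Hole \<Rightarrow> (case ren (resolve env) 0 M of
              Var n \<Rightarrow> Var n
            | Lam A \<Rightarrow> Lam (plug_aux (Inr A))
            | App A B \<Rightarrow> App (plug_aux (Inr A)) (plug_aux (Inr B)))))"

definition plug :: "ctx \<Rightarrow> trm \<Rightarrow> trm" where
  "plug C M = plug_aux (Inl ([], C, M))"

end

theory Submission
  imports Defs
begin

text \<open>Let gen A B mean that B arises from A by replacing subterms without head normal form
by arbitrary terms. Having a head normal form is reflected by substitution and by passing to the
function part of an application, so a weak head step of a term with head normal form never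
exposes a replaced subterm and is mirrored on the other side of gen. Kashima's standardisation
turns a reduction to Cstar into weak head reductions followed by reductions below the constructor
reached. As Cstar is a normal form in Lambda001, every term met on the way has a head normal
form, so the whole reduction is mirrored; no infinitary confluence is needed. Finally, unsolvable
terms have no head normal form, by the usual choice of selectors as arguments.\<close>

section \<open>Simultaneous substitution\<close>

text \<open>The cutoff of \<open>ren\<close> is absorbed into the map itself, which frees the
  composition laws from arithmetic on depths.\<close>

primcorec rn :: "(nat \<Rightarrow> nat) \<Rightarrow> trm \<Rightarrow> trm" where
  "rn f M = (case M of
      Var n \<Rightarrow> Var (f n)
    | Lam P \<Rightarrow> Lam (rn (case_nat 0 (\<lambda>n. Suc (f n))) P)
    | App P Q \<Rightarrow> App (rn f P) (rn f Q))"

lemma rn_simps [simp]: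
  "rn f (Var n) = Var (f n)"
  "rn f (Lam P) = Lam (rn (case_nat 0 (\<lambda>n. Suc (f n))) P)"
  "rn f (App P Q) = App (rn f P) (rn f Q)"
  by (subst rn.code; simp)+

definition up :: "(nat \<Rightarrow> trm) \<Rightarrow> nat \<Rightarrow> trm" where
  "up \<sigma> = case_nat (Var 0) (\<lambda>n. rn Suc (\<sigma> n))"

lemma up_simps [simp]: "up \<sigma> 0 = Var 0" "up \<sigma> (Suc n) = rn Suc (\<sigma> n)"
  by (simp_all add: up_def)

lemma up_eqI: "\<tau> 0 = Var 0 \<Longrightarrow> (\<And>n. \<tau> (Suc n) = rn Suc (\<sigma> n)) \<Longrightarrow> up \<sigma> = \<tau>"
  by (rule ext) (simp add: up_def split: nat.split)

primcorec sb :: "(nat \<Rightarrow> trm) \<Rightarrow> trm \<Rightarrow> trm" where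
  "sb \<sigma> M = (case M of
      Var n \<Rightarrow> \<sigma> n
    | Lam P \<Rightarrow> Lam (sb (up \<sigma>) P)
    | App P Q \<Rightarrow> App (sb \<sigma> P) (sb \<sigma> Q))"

lemma sb_simps [simp]:
  "sb \<sigma> (Var n) = \<sigma> n"
  "sb \<sigma> (Lam P) = Lam (sb (up \<sigma>) P)"
  "sb \<sigma> (App P Q) = App (sb \<sigma> P) (sb \<sigma> Q)"
  by (subst sb.code; simp)+

text \<open>Bisimulation up to equality. Equal variables fall under \<open>A = B\<close>, so each
  later use only has to say how its invariant passes under a binder.\<close>

lemma trm_eq_coinduct [consumes 1, case_names step]:
  assumes "R A B"
    and "\<And>A B. R A B \<Longrightarrow> A = B \<or> (\<exists>P P'. A = Lam P \<and> B = Lam P' \<and> R P P') \<or>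
      (\<exists>P Q P' Q'. A = App P Q \<and> B = App P' Q' \<and> R P P' \<and> R Q Q')"
  shows "A = B"
  using assms(1)
proof (coinduction arbitrary: A B rule: trm.coinduct_strong)
  case (Eq_trm A B)
  from assms(2)[OF this] show ?case by auto
qed

lemma sb_rn: "sb \<sigma> (rn f M) = sb (\<lambda>n. \<sigma> (f n)) M"
proof (coinduction arbitrary: M \<sigma> f rule: trm_eq_coinduct)
  case step
  \<comment> \<open>Below \<open>Lam\<close> the invariant must recur with lifted maps, so the lift
    of a composite has to be the composite of the lifts. The laws that follow have the same pattern,
    each relying on earlier ones.\<close>
  have "up (\<lambda>n. \<sigma> (f n)) = (\<lambda>n. up \<sigma> (case_nat 0 (\<lambda>n. Suc (f n)) n))"
    by (rule up_eqI) simp_all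
  then show ?case by (cases M) auto
qed

lemma rn_eq_sb: "rn f M = sb (\<lambda>n. Var (f n)) M"
proof (coinduction arbitrary: M f rule: trm_eq_coinduct)
  case step
  have "up (\<lambda>n. Var (f n)) = (\<lambda>n. Var (case_nat 0 (\<lambda>n. Suc (f n)) n))"
    by (rule up_eqI) simp_all
  then show ?case by (cases M) auto
qed

lemma rn_rn: "rn f (rn g M) = rn (\<lambda>n. f (g n)) M"
  unfolding rn_eq_sb[of f "rn g M"] sb_rn by (rule rn_eq_sb[symmetric])

lemma rn_sb: "rn f (sb \<sigma> M) = sb (\<lambda>n. rn f (\<sigma> n)) M"
proof (coinduction arbitrary: M \<sigma> f rule: trm_eq_coinduct)
  case step
  have "up (\<lambda>n. rn f (\<sigma> n)) = (\<lambda>n. rn (case_nat 0 (\<lambda>n. Suc (f n))) (up \<sigma> n))"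
    by (rule up_eqI) (simp_all add: rn_rn)
  then show ?case by (cases M) auto
qed

lemma sb_sb: "sb \<sigma> (sb \<tau> M) = sb (\<lambda>n. sb \<sigma> (\<tau> n)) M"
proof (coinduction arbitrary: M \<sigma> \<tau> rule: trm_eq_coinduct)
  case step
  have "up (\<lambda>n. sb \<sigma> (\<tau> n)) = (\<lambda>n. sb (up \<sigma>) (up \<tau> n))"
    by (rule up_eqI) (simp_all add: rn_sb sb_rn)
  then show ?case by (cases M) auto
qed

lemma sb_Var [simp]: "sb Var M = M"
proof (coinduction arbitrary: M rule: trm_eq_coinduct)
  case step
  have "up Var = Var"
    by (rule up_eqI) simp_all
  then show ?case by (cases M) auto
qed

section \<open>The given de Bruijn operations as instances of \<open>rn\<close> and
  \<open>sb\<close>\<close>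

lemma ren_simps [simp]:
  "ren f c (Var n) = Var (if n < c then n else f (n - c) + c)"
  "ren f c (Lam P) = Lam (ren f (Suc c) P)"
  "ren f c (App P Q) = App (ren f c P) (ren f c Q)"
  by (subst ren.code; simp)+

lemma ren_eq_rn: "ren f c M = rn (\<lambda>n. if n < c then n else f (n - c) + c) M"
proof (coinduction arbitrary: M c rule: trm_eq_coinduct)
  case step
  have "case_nat 0 (\<lambda>n. Suc (if n < c then n else f (n - c) + c)) =
      (\<lambda>n. if n < Suc c then n else f (n - Suc c) + Suc c)"
    by (rule ext) (simp split: nat.split)
  then show ?case by (cases M) auto
qed

text \<open>The state \<open>Inr\<close> only serves guardedness: primitive corecursion cannot
  return the inserted term at once and copies it node by node.\<close>

lemma bsub_Inr: "bsub (Inr P) = P"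
proof (coinduction arbitrary: P rule: trm_eq_coinduct)
  case step
  show ?case by (cases P) (subst (1 2 3) bsub.code, force)+
qed

lemma bsub_Inl_simps:
  "bsub (Inl (Var n, k, N)) = (if n = k then N else if n < k then Var n else Var (n - 1))"
  "bsub (Inl (Lam P, k, N)) = Lam (bsub (Inl (P, Suc k, ren Suc 0 N)))"
  "bsub (Inl (App P Q, k, N)) = App (bsub (Inl (P, k, N))) (bsub (Inl (Q, k, N)))"
  by (subst bsub.code; cases N; simp add: bsub_Inr)+

lemma bsub_Inl:
  "bsub (Inl (M, k, N)) = sb (\<lambda>n. if n = k then N else if n < k then Var n else Var (n - 1)) M"
proof (coinduction arbitrary: M k N rule: trm_eq_coinduct)
  case step
  have "up (\<lambda>n. if n = k then N else if n < k then Var n else Var (n - 1)) =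
      (\<lambda>n. if n = Suc k then ren Suc 0 N else if n < Suc k then Var n else Var (n - 1))"
    by (rule up_eqI) (auto simp: ren_eq_rn)
  then show ?case
    by (cases M) (auto simp: bsub_Inl_simps)
qed

lemma subst_eq_sb: "subst M N = sb (case_nat N Var) M"
proof -
  have "(\<lambda>n. if n = 0 then N else if n < 0 then Var n else Var (n - 1)) = case_nat N Var"
    by (rule ext) (simp split: nat.split)
  then show ?thesis by (simp only: subst_def bsub_Inl)
qed

text \<open>The substitution lemma, by which \<open>beta\<close> and \<open>wh\<close> are stable
  under substitution.\<close>

lemma sb_subst: "sb \<sigma> (subst M N) = subst (sb (up \<sigma>) M) (sb \<sigma> N)"
proof -
  have "(\<lambda>n. sb \<sigma> (case n of 0 \<Rightarrow> N | Suc m \<Rightarrow> Var m)) = (\<lambda>n. sb (case_nat (sb \<sigma> N) Var) (up \<sigma> n))"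
    by (rule ext) (simp add: sb_rn split: nat.split)
  then show ?thesis by (simp add: subst_eq_sb sb_sb)
qed

lemma beta_sb: "beta M M' \<Longrightarrow> beta (sb \<sigma> M) (sb \<sigma> M')"
  by (induction arbitrary: \<sigma> rule: beta.induct) (auto simp: sb_subst intro: beta.intros)

lemma beta_star_map:
  assumes "\<And>M M'. beta M M' \<Longrightarrow> beta (F M) (F M')" and "beta_star M M'"
  shows "beta_star (F M) (F M')"
  using assms(2) by induction (auto intro: assms(1) rtranclp.rtrancl_into_rtrancl)

section \<open>Weak head reduction and standard reductions\<close>

inductive wh :: "trm \<Rightarrow> trm \<Rightarrow> bool" where
  wh_beta: "wh (App (Lam M) N) (subst M N)"
| wh_app: "wh M M' \<Longrightarrow> wh (App M N) (App M' N)"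

abbreviation wh_star :: "trm \<Rightarrow> trm \<Rightarrow> bool" where
  "wh_star \<equiv> wh\<^sup>*\<^sup>*"

lemma wh_imp_beta: "wh M M' \<Longrightarrow> beta M M'"
  by (induction rule: wh.induct) (auto intro: beta.intros)

lemma wh_star_imp_beta_star: "wh_star M M' \<Longrightarrow> beta_star M M'"
  by (rule mono_rtranclp[rule_format, OF _ , of wh]) (auto intro: wh_imp_beta)

lemma wh_sb: "wh M M' \<Longrightarrow> wh (sb \<sigma> M) (sb \<sigma> M')"
  by (induction rule: wh.induct) (auto simp: sb_subst intro: wh.intros)

lemma wh_star_sb: "wh_star M M' \<Longrightarrow> wh_star (sb \<sigma> M) (sb \<sigma> M')"
  by (induction rule: rtranclp_induct) (auto intro: wh_sb rtranclp.rtrancl_into_rtrancl)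

lemma wh_star_app: "wh_star M M' \<Longrightarrow> wh_star (App M N) (App M' N)"
  by (induction rule: rtranclp_induct) (auto intro: wh_app rtranclp.rtrancl_into_rtrancl)

text \<open>Kashima's standard reductions, read coinductively. The 001 restriction is not imposed
here; it is recovered from the target.\<close>
coinductive st :: "trm \<Rightarrow> trm \<Rightarrow> bool" where
  st_Var: "wh_star M (Var x) \<Longrightarrow> st M (Var x)"
| st_Lam: "wh_star M (Lam P) \<Longrightarrow> st P P' \<Longrightarrow> st M (Lam P')"
| st_App: "wh_star M (App P Q) \<Longrightarrow> st P P' \<Longrightarrow> st Q Q' \<Longrightarrow> st M (App P' Q')"

inductive_cases st_VarE: "st M (Var x)"
inductive_cases st_LamE: "st M (Lam P)"
inductive_cases st_AppE: "st M (App P Q)"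

lemma st_refl: "st M M"
proof (coinduction arbitrary: M)
  case st
  show ?case by (cases M) blast+
qed

lemma wh_star_st: "wh_star M M' \<Longrightarrow> st M' N \<Longrightarrow> st M N"
  by (erule st.cases) (auto intro: st.intros rtranclp_trans)

lemma st_rn: "st M M' \<Longrightarrow> st (rn f M) (rn f M')"
proof (coinduction arbitrary: M M' f)
  case st
  then show ?case
  proof cases
    case (st_Var x)
    then show ?thesis using wh_star_sb[of M "Var x" "\<lambda>n. Var (f n)"] by (simp add: rn_eq_sb)
  next
    case (st_Lam P P')
    have "wh_star (rn f M) (rn f (Lam P))" using st_Lam by (simp only: rn_eq_sb wh_star_sb)
    with st_Lam show ?thesis by auto
  next
    case (st_App P Q P' Q')
    have "wh_star (rn f M) (rn f (App P Q))" using st_App by (simp only: rn_eq_sb wh_star_sb)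
    then show ?thesis unfolding st_App(1) rn_simps using st_App(3,4) by blast
  qed
qed

text \<open>Where \<open>M'\<close> is a variable \<open>x\<close>, weak head steps lead from
  \<open>sb \<sigma> M\<close> to \<open>\<sigma> x\<close> and are put in front of the standard
  reduction of \<open>\<sigma> x\<close>. In the other cases the root constructor survives the
  substitution.\<close>

lemma st_sb:
  assumes "st M M'" and "\<And>n. st (\<sigma> n) (\<tau> n)"
  shows "st (sb \<sigma> M) (sb \<tau> M')"
proof -
  have "\<forall>n. st (\<sigma> n) (\<tau> n)" using assms(2) by blast
  with assms(1) show ?thesis
  proof (coinduction arbitrary: M M' \<sigma> \<tau>)
    case st
    from st(1) show ?case
    proof cases
      case (st_Var x)
      have "wh_star (sb \<sigma> M) (\<sigma> x)" using wh_star_sb[OF st_Var(2), of \<sigma>] by simp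
      then have "st (sb \<sigma> M) (\<tau> x)" using st(2) wh_star_st by blast
      then show ?thesis unfolding st_Var(1) sb_simps by cases auto
    next
      case (st_Lam P P')
      have "\<forall>n. st (up \<sigma> n) (up \<tau> n)"
        using st(2) by (auto simp: up_def intro: st_rn st_refl split: nat.split)
      moreover have "wh_star (sb \<sigma> M) (Lam (sb (up \<sigma>) P))" using wh_star_sb[OF st_Lam(2), of \<sigma>] by simp
      ultimately show ?thesis unfolding st_Lam(1) sb_simps using st_Lam(3) by blast
    next
      case (st_App P Q P' Q')
      have "wh_star (sb \<sigma> M) (App (sb \<sigma> P) (sb \<sigma> Q))" using wh_star_sb[OF st_App(2), of \<sigma>] by simp
      then show ?thesis unfolding st_App(1) sb_simps using st_App(3,4) st(2) by blast
    qed
  qed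
qed

lemma st_subst: "st M M' \<Longrightarrow> st N N' \<Longrightarrow> st (subst M N) (subst M' N')"
  unfolding subst_eq_sb by (rule st_sb) (auto intro: st_refl split: nat.split)

text \<open>A root redex in the target stems from weak head prefixes that already expose a redex
  \<open>App (Lam P0) B\<close>; contracting it is one more weak head step, and
  \<open>st_subst\<close> supplies the rest. Inner redexes are handled by induction.\<close>

lemma st_beta: "beta N N' \<Longrightarrow> st M N \<Longrightarrow> st M N'"
proof (induction arbitrary: M rule: beta.induct)
  case (1 P Q)
  then obtain A B where *: "wh_star M (App A B)" "st A (Lam P)" "st B Q" by (elim st_AppE)
  then obtain P0 where P0: "wh_star A (Lam P0)" "st P0 P" by (elim st_LamE)
  have "wh_star M (App (Lam P0) B)" using * wh_star_app[OF P0(1)] by (meson rtranclp_trans)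
  then have "wh_star M (subst P0 B)" using wh_beta by (meson rtranclp.rtrancl_into_rtrancl)
  then show ?case using st_subst[OF P0(2) *(3)] by (rule wh_star_st)
next
  case (2 P P')
  then show ?case by (blast elim: st_LamE intro: st_Lam)
next
  case (3 P P' Q)
  then show ?case by (blast elim: st_AppE intro: st_App)
next
  case (4 Q Q' P)
  then show ?case by (blast elim: st_AppE intro: st_App)
qed

lemma st_beta_star: "beta_star N N' \<Longrightarrow> st M N \<Longrightarrow> st M N'"
  by (induction rule: rtranclp_induct) (auto intro: st_beta)

lemma binf_imp_st:
  assumes "binf M N" shows "st M N"
proof -
  \<comment> \<open>The invariant carries a standard prefix, since every layer of
    \<open>binf\<close> opens with arbitrary beta steps that the prefix has to absorb.\<close>
  have "\<exists>L. st M L \<and> binf L N" using assms st_refl by blast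
  then show ?thesis
  proof (coinduction arbitrary: M N)
    case st
    then obtain L where L: "st M L" "binf L N" by blast
    from L(2) have "binf_step binf L N" by (cases rule: binf.cases)
    then show ?case
    proof cases
      case (bvar x)
      have "wh_star M (Var x)" using st_beta_star[OF bvar(2) L(1)] by (rule st_VarE)
      with bvar(1) show ?thesis by simp
    next
      case (blam P P')
      obtain R where "wh_star M (Lam R)" "st R P"
        using st_beta_star[OF blam(2) L(1)] by (rule st_LamE)
      then show ?thesis unfolding blam(1) using binf.intros[OF blam(3)] by blast
    next
      case (bapp P Q P' Q')
      obtain R S where "wh_star M (App R S)" "st R P" "st S Q"
        using st_beta_star[OF bapp(2) L(1)] by (rule st_AppE)
      then show ?thesis unfolding bapp(1) using binf.intros[OF bapp(3)] bapp(4) by blast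
    qed
  qed
qed

section \<open>Head normalisation\<close>

text \<open>neu y n M: M is the variable y applied to n arguments.\<close>
inductive neu :: "nat \<Rightarrow> nat \<Rightarrow> trm \<Rightarrow> bool" for y where
  neu_Var: "neu y 0 (Var y)"
| neu_App: "neu y n P \<Longrightarrow> neu y (Suc n) (App P Q)"

inductive_cases neu_AppE: "neu y n (App P Q)"

text \<open>Derivations follow head reduction: weak head steps, then passage below an abstraction,
  and so on until a head variable appears.\<close>

inductive hn :: "trm \<Rightarrow> bool" where
  hn_neu: "neu y n M \<Longrightarrow> hn M"
| hn_Lam: "hn P \<Longrightarrow> hn (Lam P)"
| hn_wh: "wh M M' \<Longrightarrow> hn M' \<Longrightarrow> hn M"

lemma hn_wh_star: "wh_star M M' \<Longrightarrow> hn M' \<Longrightarrow> hn M"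
  by (induction rule: converse_rtranclp_induct) (auto intro: hn_wh)

lemma neu_sbD: "neu y n (sb \<sigma> M) \<Longrightarrow> \<exists>y n. neu y n M"
proof (induction n "sb \<sigma> M" arbitrary: M rule: neu.induct)
  case neu_Var
  then show ?case by (cases M) (auto intro: neu.intros)
next
  case (neu_App n P Q)
  then show ?case by (cases M) (auto intro: neu.intros, blast intro: neu.intros)
qed

text \<open>Either the redex lies already in \<open>M\<close>, or the substitution has put a term at
  the head of \<open>M\<close>, and then that head is a variable.\<close>

lemma wh_sbD:
  "wh (sb \<sigma> M) A \<Longrightarrow> (\<exists>y n. neu y n M) \<or> (\<exists>M'. wh M M' \<and> A = sb \<sigma> M')"
proof (induction "sb \<sigma> M" A arbitrary: M rule: wh.induct)
  case (wh_beta P Q)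
  show ?case
  proof (cases M)
    case (App M1 M2)
    with wh_beta have *: "sb \<sigma> M1 = Lam P" "Q = sb \<sigma> M2" by auto
    show ?thesis
    proof (cases M1)
      case (Lam R)
      then have "wh M (subst R M2) \<and> subst P Q = sb \<sigma> (subst R M2)"
        using * App by (auto simp: sb_subst intro: wh.wh_beta)
      then show ?thesis by blast
    next
      case (Var x)
      then show ?thesis using App by (blast intro: neu.intros)
    qed (use * in simp)
  qed (use wh_beta in \<open>auto intro: neu.intros\<close>)
next
  case (wh_app P P' Q)
  show ?case
  proof (cases M)
    case (App M1 M2)
    with wh_app have *: "P = sb \<sigma> M1" "Q = sb \<sigma> M2" by auto
    from wh_app(2)[OF *(1)] show ?thesis
      unfolding App using *(2) by (metis neu.neu_App wh.wh_app sb_simps(3))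
  qed (use wh_app in \<open>auto intro: neu.intros\<close>)
qed

text \<open>Head reduction of the instance copies that of \<open>M\<close> until \<open>M\<close>
  exposes a head variable, and at that point \<open>M\<close> is head normalising already.\<close>

lemma hn_sbD: "hn (sb \<sigma> M) \<Longrightarrow> hn M"
proof (induction "sb \<sigma> M" arbitrary: \<sigma> M rule: hn.induct)
  case (hn_neu y n)
  then show ?case using neu_sbD hn.hn_neu by blast
next
  case (hn_Lam P)
  then show ?case by (cases M) (auto intro: hn.hn_neu neu.intros hn.hn_Lam)
next
  case (hn_wh A)
  then show ?case using wh_sbD hn.hn_neu hn.hn_wh by metis
qed

text \<open>Steps inside \<open>P\<close> are followed by induction. When \<open>P\<close> is an
  abstraction that gets consumed, the contractum is a substitution instance of its body, so
  \<open>hn_sbD\<close> applies to the body.\<close>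

lemma hn_AppD: "hn (App P Q) \<Longrightarrow> hn P"
proof (induction "App P Q" arbitrary: P Q rule: hn.induct)
  case (hn_neu y n)
  then show ?case by (auto elim: neu_AppE intro: hn.hn_neu)
next
  case (hn_wh A)
  from hn_wh(1) show ?case
  proof cases
    case (wh_beta R)
    with hn_wh(2) show ?thesis by (auto simp: subst_eq_sb dest: hn_sbD intro: hn.hn_Lam)
  next
    case (wh_app P')
    with hn_wh(3) show ?thesis by (auto intro: hn.hn_wh)
  qed
qed

lemma st_neu: "neu y n N \<Longrightarrow> st M N \<Longrightarrow> \<exists>M'. wh_star M M' \<and> neu y n M'"
proof (induction arbitrary: M rule: neu.induct)
  case neu_Var
  then show ?case by (auto elim: st_VarE intro: neu.intros)
next
  case (neu_App n P Q)
  then obtain A B where *: "wh_star M (App A B)" "st A P" by (elim st_AppE)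
  with neu_App.IH obtain A' where "wh_star A A'" "neu y n A'" by blast
  then show ?case using *(1) by (meson neu.neu_App rtranclp_trans wh_star_app)
qed

text \<open>The inductive layer of the 001 condition makes the function spine finite, so it ends in
  a head; a normal form has no abstraction there.\<close>

lemma nf_neu:
  assumes "t001_step Y N" and "\<not> has_redex N" and "\<And>P. N \<noteq> Lam P"
  shows "\<exists>y n. neu y n N"
  using assms
proof (induction rule: t001_step.induct)
  case (3 P Q)
  then have "\<And>R. P \<noteq> Lam R" "\<not> has_redex P" by (auto intro: has_redex.intros)
  with 3 show ?case by (blast intro: neu.intros)
qed (auto intro: neu.intros)

text \<open>This is where the 001 shape of the target replaces a guard on \<open>st\<close>: the
  induction runs along the abstractions and function positions of \<open>N\<close>.\<close>

lemma st_nf_hn: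
  assumes "t001_step Y N" and "\<not> has_redex N" and "st M N"
  shows "hn M"
  using assms
proof (induction arbitrary: M rule: t001_step.induct)
  case (1 x)
  then show ?case by (auto elim!: st_VarE intro: hn_wh_star hn_neu neu.intros)
next
  case (2 P)
  then show ?case by (auto elim!: st_LamE intro: hn_wh_star hn_Lam has_redex.intros)
next
  case (3 P Q)
  then have "\<exists>y n. neu y n (App P Q)" using nf_neu[OF t001_step.intros(3)] by blast
  then show ?case using 3 st_neu hn_wh_star hn_neu by metis
qed

section \<open>Head normalising terms are solvable\<close>

text \<open>The term \<lambda>z1 ... zn x. x, which discards \<open>n\<close> arguments and is then
  the identity.\<close>

definition selector :: "nat \<Rightarrow> trm" where
  "selector n = (Lam ^^ n) (Lam (Var 0))"

lemma selector_simps: "selector 0 = Lam (Var 0)" "selector (Suc n) = Lam (selector n)"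
  by (simp_all add: selector_def)

lemma sb_selector [simp]: "sb \<sigma> (selector n) = selector n"
  by (induction n arbitrary: \<sigma>) (auto simp: selector_simps)

lemma t001_selector: "t001 (selector n)"
proof -
  have "t001_step Y (selector n)" for Y
    by (induction n) (auto simp: selector_simps intro: t001_step.intros)
  then show ?thesis by (rule t001.intros)
qed

lemma beta_selector: "beta (App (selector (Suc n)) Q) (selector n)"
  using beta.intros(1)[of "selector n" Q] by (simp add: selector_simps subst_eq_sb)

lemma beta_foldl_App: "beta M M' \<Longrightarrow> beta (foldl App M Ns) (foldl App M' Ns)"
  by (induction Ns arbitrary: M M') (auto intro: beta.intros)

lemma beta_star_foldl_App: "beta_star M M' \<Longrightarrow> beta_star (foldl App M Ns) (foldl App M' Ns)"
  by (rule beta_star_map) (rule beta_foldl_App)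

lemma beta_funpow_Lam: "beta M M' \<Longrightarrow> beta ((Lam ^^ m) M) ((Lam ^^ m) M')"
  by (induction m) (auto intro: beta.intros)

lemma beta_star_funpow_Lam: "beta_star M M' \<Longrightarrow> beta_star ((Lam ^^ m) M) ((Lam ^^ m) M')"
  by (rule beta_star_map) (rule beta_funpow_Lam)

lemma selector_consumes: "beta_star (foldl App (selector (length Ns)) Ns) (Lam (Var 0))"
proof (induction Ns)
  case (Cons N Ns)
  have "beta (foldl App (selector (length (N # Ns))) (N # Ns)) (foldl App (selector (length Ns)) Ns)"
    by (simp add: beta_foldl_App beta_selector)
  then show ?case using Cons by (rule converse_rtranclp_into_rtranclp)
qed (simp add: selector_simps)

lemma neu_sb_selector:
  "neu y n M \<Longrightarrow> \<sigma> y = selector (n + k) \<Longrightarrow> beta_star (sb \<sigma> M) (selector k)"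
proof (induction arbitrary: k rule: neu.induct)
  case (neu_App n P Q)
  then have "beta_star (sb \<sigma> P) (selector (Suc k))" by simp
  then have "beta_star (App (sb \<sigma> P) (sb \<sigma> Q)) (App (selector (Suc k)) (sb \<sigma> Q))"
    by (rule beta_star_map[rotated]) (rule beta.intros)
  then show ?case using beta_selector by (auto intro: rtranclp.rtrancl_into_rtrancl)
qed simp

lemma neu_sb: "neu y n M \<Longrightarrow> \<sigma> y = Var z \<Longrightarrow> neu z n (sb \<sigma> M)"
  by (induction rule: neu.induct) (auto intro: neu.intros)

lemma sb_funpow_Lam: "sb \<sigma> ((Lam ^^ m) M) = (Lam ^^ m) (sb ((up ^^ m) \<sigma>) M)"
  by (induction m arbitrary: \<sigma>) (auto simp: funpow_swap1[of up])

lemma up_funpow_less: "y < m \<Longrightarrow> (up ^^ m) \<sigma> y = Var y"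
proof (induction m arbitrary: y)
  case (Suc m)
  then show ?case by (cases y) auto
qed simp

lemma up_funpow_selector: "\<sigma> 0 = selector n \<Longrightarrow> (up ^^ m) \<sigma> m = selector n"
  by (induction m) (auto simp: rn_eq_sb)

text \<open>Feeding the same selector to all binders avoids singling out the one that binds
  \<open>y\<close>. Once the outermost binder is the right one, the head discards its own
  \<open>n\<close> arguments; the identity below the other \<open>m\<close> binders is
  \<open>selector m\<close>, which discards the other \<open>m\<close> arguments.\<close>

lemma neu_bound_solvable:
  "neu y n M \<Longrightarrow> y < m \<Longrightarrow>
    beta_star (foldl App ((Lam ^^ m) M) (replicate m (selector n))) (Lam (Var 0))"
proof (induction m arbitrary: M)
  case (Suc m)
  let ?Ns = "replicate m (selector n)"
  define \<tau> where "\<tau> = (up ^^ m) (case_nat (selector n) Var)"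
  have "beta (App (Lam ((Lam ^^ m) M)) (selector n)) ((Lam ^^ m) (sb \<tau> M))"
    using beta.intros(1)[of "(Lam ^^ m) M" "selector n"]
    by (simp add: subst_eq_sb sb_funpow_Lam \<tau>_def)
  then have "beta (foldl App ((Lam ^^ Suc m) M) (replicate (Suc m) (selector n)))
      (foldl App ((Lam ^^ m) (sb \<tau> M)) ?Ns)"
    by (simp add: beta_foldl_App)
  moreover have "beta_star (foldl App ((Lam ^^ m) (sb \<tau> M)) ?Ns) (Lam (Var 0))"
  proof (cases "y = m")
    case True
    then have "\<tau> y = selector (n + 0)" by (simp add: \<tau>_def up_funpow_selector)
    then have "beta_star (sb \<tau> M) (selector 0)" using Suc.prems(1) neu_sb_selector by blast
    then have "beta_star (foldl App ((Lam ^^ m) (sb \<tau> M)) ?Ns) (foldl App (selector m) ?Ns)"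
      using beta_star_foldl_App beta_star_funpow_Lam by (metis selector_def funpow_0)
    also have "beta_star (foldl App (selector m) ?Ns) (Lam (Var 0))"
      using selector_consumes[of ?Ns] by simp
    finally show ?thesis .
  next
    case False
    then have "y < m" using Suc.prems(2) by simp
    then have "neu y n (sb \<tau> M)" using Suc.prems(1) by (simp add: neu_sb \<tau>_def up_funpow_less)
    then show ?thesis using \<open>y < m\<close> Suc.IH by blast
  qed
  ultimately show ?case by (rule converse_rtranclp_into_rtranclp)
qed simp

lemma hn_hnf: "hn M \<Longrightarrow> \<exists>m y n T. beta_star M ((Lam ^^ m) T) \<and> neu y n T"
proof (induction rule: hn.induct)
  case (hn_neu y n M)
  then have "beta_star M ((Lam ^^ 0) M) \<and> neu y n M" by simp
  then show ?case by blast
next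
  case (hn_Lam P)
  then obtain m y n T where *: "beta_star P ((Lam ^^ m) T)" "neu y n T" by blast
  have "beta_star (Lam P) ((Lam ^^ Suc m) T)"
    using beta_star_funpow_Lam[OF *(1), of 1] by simp
  with *(2) show ?case by blast
next
  case (hn_wh M M')
  then show ?case by (meson wh_imp_beta converse_rtranclp_into_rtranclp)
qed

lemma beta_star_abstr: "beta_star M M' \<Longrightarrow> beta_star (abstr x M) (abstr x M')"
  by (rule beta_star_map) (simp add: abstr_def ren_eq_rn rn_eq_sb beta.intros beta_sb)

lemma ren_funpow_Lam: "ren f c ((Lam ^^ m) M) = (Lam ^^ m) (ren f (c + m) M)"
  by (induction m arbitrary: c) auto

lemma binf_I: "beta_star M (Lam (Var 0)) \<Longrightarrow> binf M (Lam (Var 0))"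
  by (rule binf.intros) (auto intro: binf_step.intros)

lemma hn_solvable:
  assumes "hn M" shows "solvable M"
proof -
  from hn_hnf[OF assms] obtain m y n T where T: "beta_star M ((Lam ^^ m) T)" "neu y n T" by blast
  have "\<exists>xs k. beta_star (foldl App (foldr abstr xs M) (replicate k (selector n))) (Lam (Var 0))"
  proof (cases "y < m")
    case True
    have "beta_star (foldl App (foldr abstr [] M) (replicate m (selector n))) (Lam (Var 0))"
      using beta_star_foldl_App[OF T(1)] neu_bound_solvable[OF T(2) True]
      by (auto intro: rtranclp_trans)
    then show ?thesis by blast
  next
    case False
    \<comment> \<open>At depth \<open>m\<close> the index \<open>y\<close> stands for the free
      variable named \<open>y - m\<close>. Abstracting it adds an outermost binder, whose index at
      that depth is \<open>m\<close>.\<close>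
    define f where "f = (\<lambda>j. if j = y - m then 0 else Suc j)"
    have *: "abstr (y - m) ((Lam ^^ m) T) = (Lam ^^ Suc m) (ren f m T)"
      by (simp add: abstr_def f_def ren_funpow_Lam)
    have "neu m n (ren f m T)"
      unfolding ren_eq_rn rn_eq_sb by (rule neu_sb[OF T(2)]) (use False in \<open>simp add: f_def\<close>)
    from neu_bound_solvable[OF this, of "Suc m"]
    have "beta_star (foldl App (foldr abstr [y - m] M) (replicate (Suc m) (selector n))) (Lam (Var 0))"
      using beta_star_foldl_App[OF beta_star_abstr[OF T(1)], of "y - m" "replicate (Suc m) (selector n)"]
      unfolding * by (auto intro: rtranclp_trans)
    then show ?thesis by blast
  qed
  then obtain xs k where
    "beta_star (foldl App (foldr abstr xs M) (replicate k (selector n))) (Lam (Var 0))" by blast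
  then show ?thesis unfolding solvable_def
    by (intro exI[of _ xs] exI[of _ "replicate k (selector n)"]) (auto simp: t001_selector binf_I)
qed

section \<open>Genericity\<close>

text \<open>Coinductive because a context may have infinitely many holes.\<close>

coinductive gen :: "trm \<Rightarrow> trm \<Rightarrow> bool" where
  gen_any: "\<not> hn M \<Longrightarrow> gen M N"
| gen_Var: "gen (Var x) (Var x)"
| gen_Lam: "gen P P' \<Longrightarrow> gen (Lam P) (Lam P')"
| gen_App: "gen P P' \<Longrightarrow> gen Q Q' \<Longrightarrow> gen (App P Q) (App P' Q')"

inductive_cases gen_VarE: "gen (Var x) N"
inductive_cases gen_LamE: "gen (Lam P) N"
inductive_cases gen_AppE: "gen (App P Q) N"

lemma gen_refl: "gen M M"
proof (coinduction arbitrary: M)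
  case gen
  show ?case by (cases M) auto
qed

lemma gen_rn: "gen M N \<Longrightarrow> gen (rn f M) (rn f N)"
proof (coinduction arbitrary: M N f)
  case gen
  then show ?case
  proof cases
    case gen_any
    then show ?thesis using hn_sbD by (auto simp: rn_eq_sb)
  qed auto
qed

text \<open>By \<open>hn_sbD\<close> a subterm without head normal form keeps this property under
  substitution, so its replacement remains licensed by \<open>gen_any\<close>.\<close>

lemma gen_sb:
  assumes "gen M N" and "\<And>n. gen (\<sigma> n) (\<tau> n)"
  shows "gen (sb \<sigma> M) (sb \<tau> N)"
proof -
  have "\<forall>n. gen (\<sigma> n) (\<tau> n)" using assms(2) by blast
  with assms(1) show ?thesis
  proof (coinduction arbitrary: M N \<sigma> \<tau>)
    case gen
    from gen(1) show ?case
    proof cases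
      case gen_any
      then have "\<not> hn (sb \<sigma> M)" using hn_sbD by blast
      then show ?thesis by simp
    next
      case (gen_Var x)
      have "gen (\<sigma> x) (\<tau> x)" using gen(2) by blast
      then show ?thesis unfolding gen_Var sb_simps by cases auto
    next
      case (gen_Lam P P')
      have "\<forall>n. gen (up \<sigma> n) (up \<tau> n)"
        using gen(2) by (auto simp: up_def intro: gen_rn gen_refl split: nat.split)
      then show ?thesis unfolding gen_Lam(1,2) sb_simps using gen_Lam(3) by blast
    next
      case (gen_App P P' Q Q')
      show ?thesis unfolding gen_App(1,2) sb_simps using gen_App(3,4) gen(2) by blast
    qed
  qed
qed

lemma gen_subst: "gen M M' \<Longrightarrow> gen N N' \<Longrightarrow> gen (subst M N) (subst M' N')"
  unfolding subst_eq_sb by (rule gen_sb) (auto intro: gen_refl split: nat.split)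

text \<open>By \<open>hn_AppD\<close> every function part down to the redex is head normalising.
  This rules out \<open>gen_any\<close> along the way, so \<open>N\<close> has a redex in the same
  place.\<close>

lemma gen_wh: "wh M M' \<Longrightarrow> hn M \<Longrightarrow> gen M N \<Longrightarrow> \<exists>N'. wh N N' \<and> gen M' N'"
proof (induction arbitrary: N rule: wh.induct)
  case (wh_beta P Q)
  then obtain F Q' where N: "N = App F Q'" "gen (Lam P) F" "gen Q Q'"
    by (blast elim: gen_AppE)
  have "hn (Lam P)" using wh_beta(1) by (rule hn_AppD)
  with N(2) obtain P' where "F = Lam P'" "gen P P'" by (blast elim: gen_LamE)
  with N show ?case using gen_subst[OF _ N(3)] wh.wh_beta[of P' Q'] by blast
next
  case (wh_app P P' Q)
  then obtain F Q' where N: "N = App F Q'" "gen P F" "gen Q Q'"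
    by (blast elim: gen_AppE)
  have "hn P" using wh_app(3) by (rule hn_AppD)
  with wh_app.IH N(2) obtain F' where "wh F F'" "gen P' F'" by blast
  from wh.wh_app[OF this(1), of Q'] gen_App[OF this(2) N(3)] show ?case
    unfolding N(1) by blast
qed

lemma gen_wh_star:
  "wh_star M M' \<Longrightarrow> hn M' \<Longrightarrow> gen M N \<Longrightarrow> \<exists>N'. wh_star N N' \<and> gen M' N'"
proof (induction arbitrary: N rule: converse_rtranclp_induct)
  case (step M M1)
  then have "hn M" by (blast intro: hn_wh hn_wh_star)
  with step obtain N1 where "wh N N1" "gen M1 N1" using gen_wh by blast
  with step show ?case by (meson converse_rtranclp_into_rtranclp)
qed blast

text \<open>One inductive layer of \<open>t001\<close> yields one inductive layer of
  \<open>binf\<close>; argument positions are handed to \<open>Y\<close>, which later becomes the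
  coinduction hypothesis.\<close>

lemma gen_binf_step:
  assumes "t001_step t001 L" and "\<not> has_redex L" and "st M L" and "gen M N"
    and Y: "\<And>M N L. t001 L \<Longrightarrow> \<not> has_redex L \<Longrightarrow> st M L \<Longrightarrow> gen M N \<Longrightarrow> Y N L"
  shows "binf_step Y N L"
  using assms(1-4)
proof (induction arbitrary: M N rule: t001_step.induct)
  case (1 x)
  then have "wh_star M (Var x)" by (blast elim: st_VarE)
  moreover have "hn (Var x)" by (blast intro: hn_neu neu_Var)
  ultimately obtain N' where "wh_star N N'" "gen (Var x) N'" using gen_wh_star 1(3) by blast
  with \<open>hn (Var x)\<close> have "wh_star N (Var x)" by (blast elim: gen_VarE)
  then show ?case by (blast intro: bvar wh_star_imp_beta_star)
next
  case (2 L)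
  then obtain P where P: "wh_star M (Lam P)" "st P L" by (blast elim: st_LamE)
  have nf: "\<not> has_redex L" using 2 by (blast intro: has_redex.intros)
  \<comment> \<open>Mirroring weak head steps requires their end point to be head normalising, which
    the normal target provides.\<close>
  have hn: "hn (Lam P)" using st_nf_hn[OF 2(1) nf P(2)] by (rule hn_Lam)
  with P(1) obtain N' where "wh_star N N'" "gen (Lam P) N'" using gen_wh_star 2(5) by blast
  with hn obtain P' where P': "wh_star N (Lam P')" "gen P P'" by (blast elim: gen_LamE)
  then show ?case using 2(2)[OF nf P(2) P'(2)] by (blast intro: blam wh_star_imp_beta_star)
next
  case (3 L K)
  then obtain P Q where P: "wh_star M (App P Q)" "st P L" "st Q K" by (blast elim: st_AppE)
  have nf: "\<not> has_redex L" "\<not> has_redex K" using 3 by (auto intro: has_redex.intros)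
  have "st (App P Q) (App L K)" using P by (blast intro: st_App)
  then have hn: "hn (App P Q)" by (rule st_nf_hn[OF t001_step.intros(3)[OF 3(1,2)] 3(4)])
  with P(1) obtain N' where "wh_star N N'" "gen (App P Q) N'" using gen_wh_star 3(6) by blast
  with hn obtain P' Q' where P': "wh_star N (App P' Q')" "gen P P'" "gen Q Q'"
    by (blast elim: gen_AppE)
  have "Y Q' K" using Y 3(2) nf(2) P(3) P'(3) by blast
  with P'(1) 3(3)[OF nf(1) P(2) P'(2)] show ?case by (blast intro: bapp wh_star_imp_beta_star)
qed

lemma gen_binf:
  assumes "t001 L" and "\<not> has_redex L" and "st M L" and "gen M N"
  shows "binf N L"
proof (rule binf.coinduct[where X = "\<lambda>N L. \<exists>M. t001 L \<and> \<not> has_redex L \<and> st M L \<and> gen M N"])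
  fix N L assume "\<exists>M. t001 L \<and> \<not> has_redex L \<and> st M L \<and> gen M N"
  then obtain M where M: "t001 L" "\<not> has_redex L" "st M L" "gen M N" by blast
  from M(1) have "t001_step t001 L" by (cases rule: t001.cases)
  from gen_binf_step[OF this M(2-4),
      \<comment> \<open>\<open>Y\<close> is the coinduction invariant itself, extended by
        \<open>binf\<close> as the rule allows.\<close>
      of "\<lambda>N L. (\<exists>M. t001 L \<and> \<not> has_redex L \<and> st M L \<and> gen M N) \<or> binf N L"]
  show "\<exists>M' N'. N = M' \<and> L = N' \<and>
      binf_step (\<lambda>N L. (\<exists>M. t001 L \<and> \<not> has_redex L \<and> st M L \<and> gen M N) \<or> binf N L) M' N'"
    by blast
qed (use assms in blast)

section \<open>Plugging into contexts\<close>

lemma plug_aux_Inr: "plug_aux (Inr P) = P"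
proof (coinduction arbitrary: P rule: trm_eq_coinduct)
  case step
  show ?case by (cases P) (subst (1 2 3) plug_aux.code, force)+
qed

lemma plug_aux_Inl_simps:
  "plug_aux (Inl (env, CVar x, M)) = Var (resolve env x)"
  "plug_aux (Inl (env, CLam x D, M)) = Lam (plug_aux (Inl (x # env, D, M)))"
  "plug_aux (Inl (env, CApp D E, M)) = App (plug_aux (Inl (env, D, M))) (plug_aux (Inl (env, E, M)))"
  "plug_aux (Inl (env, Hole, M)) = ren (resolve env) 0 M"
  by (subst plug_aux.code; simp add: plug_aux_Inr split: trm.split)+

text \<open>Capture is harmless: each hole receives a renaming of \<open>M\<close>, and by
  \<open>hn_sbD\<close> no renaming creates a head normal form.\<close>

lemma gen_plug:
  assumes "\<not> hn M" shows "gen (plug C M) (plug C N)"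
proof -
  have "gen (plug_aux (Inl (env, C, M))) (plug_aux (Inl (env, C, N)))" for env
  proof (coinduction arbitrary: env C)
    case gen
    show ?case
    proof (cases C)
      case Hole
      have "\<not> hn (ren (resolve env) 0 M)"
        unfolding ren_eq_rn rn_eq_sb using assms hn_sbD by blast
      then show ?thesis by (simp add: Hole plug_aux_Inl_simps)
    qed (auto simp: plug_aux_Inl_simps)
  qed
  then show ?thesis by (simp add: plug_def)
qed

theorem mainTheorem20:
  fixes M N Cstar :: trm and C :: ctx
  assumes "t001 M" and "\<not> solvable M"
    and "c001 C"
    and "t001 Cstar" and "\<not> has_redex Cstar" and "binf (plug C M) Cstar"
    and "t001 N"
  shows "binf (plug C N) Cstar"
proof -
  have "\<not> hn M" using assms(2) hn_solvable by blast
  then have "gen (plug C M) (plug C N)" by (rule gen_plug)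
  with assms(4,5) binf_imp_st[OF assms(6)] show ?thesis by (rule gen_binf)
qed

end
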